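(* Let $\mathfrak{A} = a_1, a_2, \dots$ be an $\mathbf{On}$-length sequence of surreal numbers. If $\lim_{i \rightarrow \mathbf{On}} a_i = \ell(\mathfrak{A}) \in \mathbf{No}$, then for every surreal $\varepsilon > 0$ there is an $N \in \mathbf{On}$ satisfying $|a_n-\ell(\mathfrak{A})| <\varepsilon$ whenever $n\in \mathbf{On}_{>N}$. Conversely, if $\ell$ is a (surreal) number such that for every surreal $\varepsilon > 0$ there is an $N \in \mathbf{On}$ satisfying $|a_n-\ell| <\varepsilon$ whenever $n\in \mathbf{On}_{>N}$, then $\lim_{i \rightarrow \mathbf{On}} a_i = \ell$.
   Context: $\mathbf{No}$ is the class of surreal numbers, $\mathbf{On}$ the class of ordinals, $\mathbf{On}_{>N}$ the class of ordinals $>N$. An $\mathbf{On}$-length sequence is one whose terms are indexed over the proper class of all ordinals (starting at index $1$). A gap is a Dedekind section of $\mathbf{No}$, i.e. a form $\{L\mid R\}$ with classes $L\cup R=\mathbf{No}$ and no $a\in L$, $b\in R$ with $a\ge b$, that cannot be represented as $\{\mathbf{No}_{<x}\mid\mathbf{No}_{\ge x}\}$ or $\{\mathbf{No}_{\le x}\mid\mathbf{No}_{>x}\}$ for some $x\in\mathbf{No}$; sections of the latter two forms are defined to be equal to $x$. $\mathbf{No}^{\mathfrak{D}}$ is the Dedekind completion of $\mathbf{No}$, containing all numbers and gaps; suprema and infima of classes of numbers are taken in $\mathbf{No}^{\mathfrak{D}}$. For $x \in \mathbf{No}^{\mathfrak{D}}$ the Dedekind representation of $x$ is $x = \{\mathbf{No}_{<x}\mid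 \mathbf{No}_{>x}\}$, and we write $\mathscr{L}_x = \mathbf{No}_{<x}$, $\mathscr{R}_x = \mathbf{No}_{>x}$. For an $\mathbf{On}$-length sequence $\mathfrak{A} = a_1,a_2,\dots$ define $$\ell(\mathfrak{A}) = \left\{ a : a < \sup \Big( \bigcup_{i \geq 1} \bigcap_{j \geq i} \mathscr{L}_{a_j} \Big) \;\middle|\; b : b > \inf \Big( \bigcup_{i \geq 1} \bigcap_{j \geq i} \mathscr{R}_{a_j} \Big) \right\}.$$ We say the limit of $\mathfrak{A}$ is $\ell$ and write $\lim_{i\to\mathbf{On}} a_i = \ell$ if the expression on the right-hand side is a Dedekind representation and $\ell = \ell(\mathfrak{A})$. *)

theory Defs
  imports "HOL-Library.Multiset"
begin

section \<open>The set-theoretic universe\<close>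

text \<open>
  The class of all sets is a type equipped with an extension map satisfying the ZFC axioms in
  second-order form, so that an Isabelle set of elements of this type plays the role of a class.
  The axiom of choice is inherited from the choice operator of HOL via replacement.
\<close>

class zfc_universe =
  fixes elts :: "'a \<Rightarrow> 'a set"
  assumes extensionality: "elts x = elts y \<Longrightarrow> x = y"
    and pairing: "\<exists>z. elts z = {x, y}"
    and union: "\<exists>z. elts z = (\<Union>y\<in>elts x. elts y)"
    and powerset: "\<exists>z. elts z = {y. elts y \<subseteq> elts x}"
    and infinity: "\<exists>z. (\<exists>e\<in>elts z. elts e = {}) \<and>
                       (\<forall>y\<in>elts z. \<exists>s\<in>elts z. elts s = insert y (elts y))"
    and separation: "\<exists>z. elts z = {y \<in> elts x. P y}"
    and replacement: "\<exists>z. elts z = f ` elts x"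
    and foundation: "wf {(x, y). x \<in> elts y}"

definition small :: "'v::zfc_universe set \<Rightarrow> bool"
  where "small A \<longleftrightarrow> (\<exists>x. elts x = A)"

definition vset :: "'v::zfc_universe set \<Rightarrow> 'v"
  where "vset A = (THE x. elts x = A)"

definition vpair :: "'v::zfc_universe \<Rightarrow> 'v \<Rightarrow> 'v"
  where "vpair x y = vset {vset {x}, vset {x, y}}"

lemma elts_vset [simp]: "small A \<Longrightarrow> elts (vset A) = A"
  unfolding small_def vset_def by (rule theI') (auto intro: extensionality)

lemma vset_elts [simp]: "vset (elts x) = x"
  unfolding vset_def by (rule the_equality) (auto intro: extensionality)

lemma small_elts [simp]: "small (elts x)"
  by (auto simp: small_def)

lemma small_empty [simp]: "small {}"
  using separation[of undefined "\<lambda>_. False"] by (simp add: small_def)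

lemma small_upair [simp]: "small {x, y}"
  using pairing by (auto simp: small_def)

lemma small_singleton [simp]: "small {x}"
  using small_upair[of x x] by simp

lemma small_image [simp]: "small A \<Longrightarrow> small ((f :: 'v::zfc_universe \<Rightarrow> 'v) ` A)"
  unfolding small_def using replacement by blast

lemma small_Un [simp]:
  assumes "small A" "small B"
  shows "small (A \<union> B)"
proof -
  have "elts (vset {vset A, vset B}) = {vset A, vset B}" by simp
  with union[of "vset {vset A, vset B}"] assms show ?thesis
    by (auto simp: small_def)
qed

lemma vpair_inject [simp]: "vpair a b = vpair c d \<longleftrightarrow> a = c \<and> b = d"
proof
  assume "vpair a b = vpair c d"
  then have "elts (vset {vset {a}, vset {a, b}}) = elts (vset {vset {c}, vset {c, d}})"
    by (simp only: vpair_def)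
  then have "{vset {a}, vset {a, b}} = {vset {c}, vset {c, d}}"
    by simp
  then have "elts ` {vset {a}, vset {a, b}} = elts ` {vset {c}, vset {c, d}}"
    by (simp only:)
  then have "{{a}, {a, b}} = {{c}, {c, d}}" by simp
  then show "a = c \<and> b = d" by (auto simp: doubleton_eq_iff)
qed simp


section \<open>Ordinals\<close>

definition Transset :: "'v::zfc_universe \<Rightarrow> bool"
  where "Transset x \<longleftrightarrow> (\<forall>y\<in>elts x. elts y \<subseteq> elts x)"

definition Ord :: "'v::zfc_universe \<Rightarrow> bool"
  where "Ord x \<longleftrightarrow> Transset x \<and> (\<forall>y\<in>elts x. Transset y)"

lemma Ord_in_Ord: "Ord x \<Longrightarrow> y \<in> elts x \<Longrightarrow> Ord y"
  unfolding Ord_def Transset_def by blast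

lemma Ord_empty: "Ord (vset {})"
  by (auto simp: Ord_def Transset_def)

lemma elts_induct: "(\<And>x. (\<And>y. y \<in> elts x \<Longrightarrow> P y) \<Longrightarrow> P x) \<Longrightarrow> P (x::'v::zfc_universe)"
  using wf_induct[OF foundation, of P x] by auto

lemma elts_irrefl: "x \<notin> elts (x::'v::zfc_universe)"
  using wf_not_refl[OF foundation, of x] by simp

lemma Ord_linear: "Ord x \<Longrightarrow> Ord y \<Longrightarrow> x \<in> elts y \<or> x = y \<or> y \<in> elts (x::'v::zfc_universe)"
proof (induction x arbitrary: y rule: elts_induct)
  case (1 x)
  note IHx = 1
  show ?case using IHx(3)
  proof (induction y rule: elts_induct)
    case (1 y)
    show ?case
    proof (rule ccontr)
      assume neg: "\<not> ?case"
      have "elts x \<subseteq> elts y"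
      proof
        fix u assume u: "u \<in> elts x"
        then have "u \<in> elts y \<or> u = y \<or> y \<in> elts u"
          using IHx(1)[OF u Ord_in_Ord[OF IHx(2) u] 1(2)] by simp
        with neg u IHx(2) show "u \<in> elts y" unfolding Ord_def Transset_def by blast
      qed
      moreover have "elts y \<subseteq> elts x"
      proof
        fix u assume u: "u \<in> elts y"
        then have "x \<in> elts u \<or> x = u \<or> u \<in> elts x"
          using 1(1)[OF u Ord_in_Ord[OF 1(2) u]] by simp
        with neg u 1(2) show "u \<in> elts x" unfolding Ord_def Transset_def by blast
      qed
      ultimately show False using neg extensionality by blast
    qed
  qed
qed

typedef (overloaded) ('v::zfc_universe) ordinal = "{x::'v. Ord x}"
  using Ord_empty by blast

instantiation ordinal :: (zfc_universe) "{wellorder, zero, one}"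
begin

definition less_ordinal :: "'a ordinal \<Rightarrow> 'a ordinal \<Rightarrow> bool"
  where "\<alpha> < \<beta> \<longleftrightarrow> Rep_ordinal \<alpha> \<in> elts (Rep_ordinal \<beta>)"

definition less_eq_ordinal :: "'a ordinal \<Rightarrow> 'a ordinal \<Rightarrow> bool"
  where "\<alpha> \<le> \<beta> \<longleftrightarrow> \<alpha> < \<beta> \<or> \<alpha> = (\<beta> :: 'a ordinal)"

definition zero_ordinal :: "'a ordinal"
  where "0 = Abs_ordinal (vset {})"

definition one_ordinal :: "'a ordinal"
  where "1 = Abs_ordinal (vset {vset {}})"

instance
proof
  fix x y z :: "'a ordinal"
  have irr: "\<not> x < x" for x :: "'a ordinal"
    by (simp add: less_ordinal_def elts_irrefl)
  have tr: "x < y \<Longrightarrow> y < z \<Longrightarrow> x < z" for x y z :: "'a ordinal"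
    using Rep_ordinal[of z] unfolding less_ordinal_def Ord_def Transset_def by blast
  show "x < y \<longleftrightarrow> x \<le> y \<and> \<not> y \<le> x"
    using irr tr by (auto simp: less_eq_ordinal_def)
  show "x \<le> x" by (simp add: less_eq_ordinal_def)
  show "x \<le> y \<Longrightarrow> y \<le> z \<Longrightarrow> x \<le> z"
    using tr by (auto simp: less_eq_ordinal_def)
  show "x \<le> y \<Longrightarrow> y \<le> x \<Longrightarrow> x = y"
    using irr tr by (auto simp: less_eq_ordinal_def)
  show "x \<le> y \<or> y \<le> x"
    using Ord_linear[of "Rep_ordinal x" "Rep_ordinal y"] Rep_ordinal[of x] Rep_ordinal[of y]
    by (auto simp: less_eq_ordinal_def less_ordinal_def Rep_ordinal_inject)
next
  fix P :: "'a ordinal \<Rightarrow> bool" and a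
  assume step: "\<And>x. (\<And>y. y < x \<Longrightarrow> P y) \<Longrightarrow> P x"
  have "wf (inv_image {(x, y). x \<in> elts y} (Rep_ordinal :: 'a ordinal \<Rightarrow> 'a))"
    by (rule wf_inv_image[OF foundation])
  then show "P a"
    by (induction a rule: wf_induct_rule) (auto intro: step simp: less_ordinal_def)
qed

end


section \<open>Surreal numbers\<close>

subsection \<open>Forms\<close>

text \<open>
  The form with left options L and right options R is coded as a Kuratowski pair of sets. Since
  \<^const>\<open>vset\<close> is unspecified on proper classes, \<^const>\<open>small\<close> is required wherever forms
  are built from classes. The operations below are total; elements that do not code pairs have no
  options and are excluded by the predicate for numbers.
\<close>

definition lopts :: "'v::zfc_universe \<Rightarrow> 'v set"
  where "lopts x = {l. \<exists>L R. x = vpair L R \<and> l \<in> elts L}"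

definition ropts :: "'v::zfc_universe \<Rightarrow> 'v set"
  where "ropts x = {r. \<exists>L R. x = vpair L R \<and> r \<in> elts R}"

definition form :: "'v::zfc_universe set \<Rightarrow> 'v set \<Rightarrow> 'v"
  where "form L R = vpair (vset L) (vset R)"

definition opt_rel :: "('v::zfc_universe \<times> 'v) set"
  where "opt_rel = {(x, y). x \<in> lopts y \<union> ropts y}"

lemma lopts_form [simp]: "small L \<Longrightarrow> lopts (form L R) = L"
  by (auto simp: lopts_def form_def)

lemma ropts_form [simp]: "small R \<Longrightarrow> ropts (form L R) = R"
  by (auto simp: ropts_def form_def)

lemma small_lopts [simp]: "small (lopts x)"
proof (cases "\<exists>L R. x = vpair L R")
  case True
  then obtain L R where "x = vpair L R" by blast
  then have "lopts x = elts L" by (auto simp: lopts_def)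
  then show ?thesis by simp
qed (simp add: lopts_def)

lemma small_ropts [simp]: "small (ropts x)"
proof (cases "\<exists>L R. x = vpair L R")
  case True
  then obtain L R where "x = vpair L R" by blast
  then have "ropts x = elts R" by (auto simp: ropts_def)
  then show ?thesis by simp
qed (simp add: ropts_def)

lemma wf_opt_rel: "wf (opt_rel :: ('v::zfc_universe \<times> 'v) set)"
proof (rule wf_subset)
  let ?m = "{(x, y). x \<in> elts (y::'v)}"
  show "wf (?m\<^sup>+)" by (rule wf_trancl[OF foundation])
  have "(l, vpair L R) \<in> ?m\<^sup>+" if "l \<in> elts L \<or> l \<in> elts R" for l L R
  proof -
    have 1: "(L, vset {L, R}) \<in> ?m\<^sup>+" "(R, vset {L, R}) \<in> ?m\<^sup>+"
      by (auto intro: r_into_trancl)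
    have 2: "(vset {L, R}, vpair L R) \<in> ?m\<^sup>+"
      by (rule r_into_trancl) (simp add: vpair_def)
    have 3: "(l, L) \<in> ?m\<^sup>+ \<or> (l, R) \<in> ?m\<^sup>+" using that by (auto intro: r_into_trancl)
    then show ?thesis
      by (elim disjE) (rule trancl_trans[OF _ trancl_trans[OF 1(1) 2]], assumption,
        rule trancl_trans[OF _ trancl_trans[OF 1(2) 2]], assumption)
  qed
  then show "opt_rel \<subseteq> ?m\<^sup>+"
    by (auto simp: opt_rel_def lopts_def ropts_def)
qed

lemma form_induct:
  assumes "\<And>x. (\<And>l. l \<in> lopts x \<Longrightarrow> P l) \<Longrightarrow> (\<And>r. r \<in> ropts x \<Longrightarrow> P r) \<Longrightarrow> P x"
  shows "P (x::'v::zfc_universe)"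
  using wf_opt_rel
proof (induction x rule: wf_induct_rule)
  case (less x)
  show ?case by (rule assms) (use less in \<open>auto simp: opt_rel_def\<close>)
qed

definition opt_mult :: "('v::zfc_universe multiset \<times> 'v multiset) set"
  where "opt_mult = mult opt_rel"

lemma wf_opt_mult: "wf opt_mult"
  unfolding opt_mult_def by (rule wf_mult[OF wf_opt_rel])

lemma opt_multI:
  assumes "l \<in> lopts x \<or> l \<in> ropts x" "N = add_mset l M" "N' = add_mset x M"
  shows "(N, N') \<in> opt_mult"
proof -
  have "(N, N') \<in> mult1 opt_rel"
    by (rule mult1I[where a = x and ?M0.0 = M and K = "{#l#}"]) (use assms in \<open>auto simp: opt_rel_def\<close>)
  then show ?thesis by (simp add: opt_mult_def mult_def)
qed

lemma opt_mult_pair: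
  assumes "l \<in> lopts x \<or> l \<in> ropts x"
  shows "({#l, y#}, {#x, y#}) \<in> opt_mult" "({#y, l#}, {#x, y#}) \<in> opt_mult"
    "({#l, y#}, {#y, x#}) \<in> opt_mult" "({#y, l#}, {#y, x#}) \<in> opt_mult"
  by (rule opt_multI[OF assms, where M = "{#y#}"]; (rule refl | rule add_mset_commute))+

subsection \<open>Order and arithmetic on forms\<close>

function (sequential) fle :: "'v::zfc_universe \<Rightarrow> 'v \<Rightarrow> bool"
  where "fle x y \<longleftrightarrow> (\<forall>l\<in>lopts x. \<not> fle y l) \<and> (\<forall>r\<in>ropts y. \<not> fle r x)"
  by pat_completeness auto
termination
proof (relation "inv_image opt_mult (\<lambda>(x, y). {#x, y#})")
  show "wf (inv_image opt_mult (\<lambda>(x, y). {#x, y#}))"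
    by (rule wf_inv_image[OF wf_opt_mult])
qed (simp_all add: opt_mult_pair)

function (sequential) fadd :: "'v::zfc_universe \<Rightarrow> 'v \<Rightarrow> 'v"
  where "fadd x y = form ((\<lambda>l. fadd l y) ` lopts x \<union> (\<lambda>l. fadd x l) ` lopts y)
                         ((\<lambda>r. fadd r y) ` ropts x \<union> (\<lambda>r. fadd x r) ` ropts y)"
  by pat_completeness auto
termination
proof (relation "inv_image opt_mult (\<lambda>(x, y). {#x, y#})")
  show "wf (inv_image opt_mult (\<lambda>(x, y). {#x, y#}))"
    by (rule wf_inv_image[OF wf_opt_mult])
qed (simp_all add: opt_mult_pair)

function (sequential) fneg :: "'v::zfc_universe \<Rightarrow> 'v"
  where "fneg x = form (fneg ` ropts x) (fneg ` lopts x)"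
  by pat_completeness auto
termination
proof (relation opt_rel)
  show "wf opt_rel" by (rule wf_opt_rel)
qed (auto simp: opt_rel_def)

declare fle.simps [simp del] fadd.simps [simp del] fneg.simps [simp del]

definition fzero :: "'v::zfc_universe"
  where "fzero = form {} {}"

inductive num :: "'v::zfc_universe \<Rightarrow> bool"
  where "small L \<Longrightarrow> small R \<Longrightarrow> (\<And>l. l \<in> L \<Longrightarrow> num l) \<Longrightarrow> (\<And>r. r \<in> R \<Longrightarrow> num r) \<Longrightarrow>
         (\<And>l r. l \<in> L \<Longrightarrow> r \<in> R \<Longrightarrow> \<not> fle r l) \<Longrightarrow> num (form L R)"


lemma opt_mult_triple:
  assumes "l \<in> lopts x \<or> l \<in> ropts x"
  shows "({#l, y, z#}, {#x, y, z#}) \<in> opt_mult" "({#y, l, z#}, {#y, x, z#}) \<in> opt_mult"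
    "({#y, z, l#}, {#y, z, x#}) \<in> opt_mult"
  by (rule opt_multI[OF assms, where M = "{#y, z#}"]; simp add: add_mset_commute)+

lemma form_induct3:
  assumes "\<And>x y z. (\<And>x' y' z'. ({#x', y', z'#}, {#x, y, z#}) \<in> opt_mult \<Longrightarrow> P x' y' z') \<Longrightarrow> P x y z"
  shows "P x y (z::'v::zfc_universe)"
proof -
  let ?m = "\<lambda>(x, y, z). {#x, y, z::'v#}"
  have "(\<lambda>(x, y, z). P x y z) (x, y, z)"
  proof (induction "(x, y, z)" arbitrary: x y z rule: wf_induct_rule[OF wf_inv_image[OF wf_opt_mult, of ?m]])
    case (1 x y z)
    have "P x y z"
      by (rule assms) (use 1 in auto)
    then show ?case by simp
  qed
  then show ?thesis by simp
qed

lemma fle_lopt: "fle x y \<Longrightarrow> l \<in> lopts x \<Longrightarrow> \<not> fle y l"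
  by (subst (asm) fle.simps) blast

lemma fle_ropt: "fle x y \<Longrightarrow> r \<in> ropts y \<Longrightarrow> \<not> fle r x"
  by (subst (asm) fle.simps) blast

lemma fleI: "(\<And>l. l \<in> lopts x \<Longrightarrow> \<not> fle y l) \<Longrightarrow> (\<And>r. r \<in> ropts y \<Longrightarrow> \<not> fle r x) \<Longrightarrow> fle x y"
  by (subst fle.simps) blast

lemma fle_refl [simp]: "fle x x"
proof (induction x rule: form_induct)
  case (1 x)
  then show ?case using fle_lopt fle_ropt by (blast intro: fleI)
qed

lemma fle_trans:
  assumes "fle x y" "fle y z"
  shows "fle x z"
proof -
  have "fle x y \<longrightarrow> fle y z \<longrightarrow> fle x z"
  proof (induction x y z rule: form_induct3)
    case (1 x y z)
    show ?case
    proof (intro impI fleI notI)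
      fix l assume a: "fle x y" "fle y z" "l \<in> lopts x" "fle z l"
      have "({#y, z, l#}, {#x, y, z#}) \<in> opt_mult"
        using opt_mult_triple(3)[of l x y z] a by (simp add: add_mset_commute)
      from 1[OF this] a have "fle y l" by simp
      with a fle_lopt show False by blast
    next
      fix r assume a: "fle x y" "fle y z" "r \<in> ropts z" "fle r x"
      have "({#r, x, y#}, {#x, y, z#}) \<in> opt_mult"
        using opt_mult_triple(1)[of r z x y] a by (simp add: add_mset_commute)
      from 1[OF this] a have "fle r y" by simp
      with a fle_ropt show False by blast
    qed
  qed
  with assms show ?thesis by blast
qed

lemma lopts_fadd: "lopts (fadd x y) = (\<lambda>l. fadd l y) ` lopts x \<union> (\<lambda>l. fadd x l) ` lopts y"
  by (subst fadd.simps) simp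

lemma ropts_fadd: "ropts (fadd x y) = (\<lambda>r. fadd r y) ` ropts x \<union> (\<lambda>r. fadd x r) ` ropts y"
  by (subst fadd.simps) simp

lemma lopts_fneg: "lopts (fneg x) = fneg ` ropts x"
  by (subst fneg.simps) simp

lemma ropts_fneg: "ropts (fneg x) = fneg ` lopts x"
  by (subst fneg.simps) simp

lemma opts_fzero [simp]: "lopts fzero = {}" "ropts fzero = {}"
  by (simp_all add: fzero_def)

lemma fadd_comm: "fadd x y = fadd y x"
proof -
  let ?m = "\<lambda>(x, y). {#x, y::'a#}"
  show ?thesis
  proof (induction "(x, y)" arbitrary: x y rule: wf_induct_rule[OF wf_inv_image[OF wf_opt_mult, of ?m]])
    case (1 x y)
    have "\<And>l. l \<in> lopts x \<or> l \<in> ropts x \<Longrightarrow> fadd l y = fadd y l"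
      "\<And>l. l \<in> lopts y \<or> l \<in> ropts y \<Longrightarrow> fadd x l = fadd l x"
      using 1 by (simp_all add: opt_mult_pair)
    then show ?case
      by (subst (1 2) fadd.simps) (simp add: Un_commute cong: image_cong)
  qed
qed

lemma fadd_assoc: "fadd (fadd x y) z = fadd x (fadd y z)"
proof (induction x y z rule: form_induct3)
  case (1 x y z)
  have "\<And>l. l \<in> lopts x \<or> l \<in> ropts x \<Longrightarrow> fadd (fadd l y) z = fadd l (fadd y z)"
    "\<And>l. l \<in> lopts y \<or> l \<in> ropts y \<Longrightarrow> fadd (fadd x l) z = fadd x (fadd l z)"
    "\<And>l. l \<in> lopts z \<or> l \<in> ropts z \<Longrightarrow> fadd (fadd x y) l = fadd x (fadd y l)"
    using 1 by (simp_all add: opt_mult_triple)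
  then show ?case
    by (subst fadd.simps, subst (2) fadd.simps)
       (simp add: lopts_fadd ropts_fadd image_Un image_image Un_assoc cong: image_cong)
qed

lemma fle_fadd_iff: "fle (fadd x y) (fadd x z) \<longleftrightarrow> fle y z"
proof (induction x y z rule: form_induct3)
  case (1 x y z)
  have X: "fle (fadd l y) (fadd l z) \<longleftrightarrow> fle y z" "fle (fadd l z) (fadd l y) \<longleftrightarrow> fle z y"
    if "l \<in> lopts x \<or> l \<in> ropts x" for l
  proof -
    have m: "({#l, y, z#}, {#x, y, z#}) \<in> opt_mult" by (rule opt_mult_triple(1)[OF that])
    show "fle (fadd l y) (fadd l z) \<longleftrightarrow> fle y z" by (rule 1[OF m])
    have m': "({#l, z, y#}, {#x, y, z#}) \<in> opt_mult" using m by (simp only: add_mset_commute[of z y])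
    show "fle (fadd l z) (fadd l y) \<longleftrightarrow> fle z y" by (rule 1[OF m'])
  qed
  have Y: "fle (fadd x l) (fadd x z) \<longleftrightarrow> fle l z" "fle (fadd x z) (fadd x l) \<longleftrightarrow> fle z l"
    if "l \<in> lopts y \<or> l \<in> ropts y" for l
  proof -
    have m: "({#x, l, z#}, {#x, y, z#}) \<in> opt_mult" by (rule opt_mult_triple(2)[OF that])
    show "fle (fadd x l) (fadd x z) \<longleftrightarrow> fle l z" by (rule 1[OF m])
    have m': "({#x, z, l#}, {#x, y, z#}) \<in> opt_mult" using m by (simp only: add_mset_commute[of z l])
    show "fle (fadd x z) (fadd x l) \<longleftrightarrow> fle z l" by (rule 1[OF m'])
  qed
  have Z: "fle (fadd x l) (fadd x y) \<longleftrightarrow> fle l y" "fle (fadd x y) (fadd x l) \<longleftrightarrow> fle y l"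
    if "l \<in> lopts z \<or> l \<in> ropts z" for l
  proof -
    have m: "({#x, y, l#}, {#x, y, z#}) \<in> opt_mult" by (rule opt_mult_triple(3)[OF that])
    show "fle (fadd x y) (fadd x l) \<longleftrightarrow> fle y l" by (rule 1[OF m])
    have m': "({#x, l, y#}, {#x, y, z#}) \<in> opt_mult" using m by (simp only: add_mset_commute[of l y])
    show "fle (fadd x l) (fadd x y) \<longleftrightarrow> fle l y" by (rule 1[OF m'])
  qed
  show ?case
  proof
    assume le: "fle y z"
    show "fle (fadd x y) (fadd x z)"
    proof (rule fleI)
      fix l assume "l \<in> lopts (fadd x y)"
      then consider xl where "xl \<in> lopts x" "l = fadd xl y" | yl where "yl \<in> lopts y" "l = fadd x yl"
        by (auto simp: lopts_fadd)
      then show "\<not> fle (fadd x z) l"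
      proof cases
        case 1
        then have "fadd xl z \<in> lopts (fadd x z)" by (simp add: lopts_fadd)
        then show ?thesis using 1 X le fle_lopt by blast
      next
        case 2
        then show ?thesis using Y le fle_lopt by blast
      qed
    next
      fix r assume "r \<in> ropts (fadd x z)"
      then consider xr where "xr \<in> ropts x" "r = fadd xr z" | zr where "zr \<in> ropts z" "r = fadd x zr"
        by (auto simp: ropts_fadd)
      then show "\<not> fle r (fadd x y)"
      proof cases
        case 1
        then have "fadd xr y \<in> ropts (fadd x y)" by (simp add: ropts_fadd)
        then show ?thesis using 1 X le fle_ropt by blast
      next
        case 2
        then show ?thesis using Z le fle_ropt by blast
      qed
    qed
  next
    assume le: "fle (fadd x y) (fadd x z)"
    show "fle y z"
    proof (rule fleI)
      fix l assume l: "l \<in> lopts y"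
      then have "fadd x l \<in> lopts (fadd x y)" by (simp add: lopts_fadd)
      then have "\<not> fle (fadd x z) (fadd x l)" using le fle_lopt by blast
      then show "\<not> fle z l" using Y l by blast
    next
      fix r assume r: "r \<in> ropts z"
      then have "fadd x r \<in> ropts (fadd x z)" by (simp add: ropts_fadd)
      then have "\<not> fle (fadd x r) (fadd x y)" using le fle_ropt by blast
      then show "\<not> fle r y" using Z r by blast
    qed
  qed
qed

lemma fle_fneg_iff: "fle (fneg x) (fneg y) \<longleftrightarrow> fle y x"
proof -
  let ?m = "\<lambda>(x, y). {#x, y::'a#}"
  show ?thesis
  proof (induction "(x, y)" arbitrary: x y rule: wf_induct_rule[OF wf_inv_image[OF wf_opt_mult, of ?m]])
    case (1 x y)
    have "\<And>r. r \<in> ropts x \<Longrightarrow> fle (fneg y) (fneg r) \<longleftrightarrow> fle r y"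
      "\<And>l. l \<in> lopts y \<Longrightarrow> fle (fneg l) (fneg x) \<longleftrightarrow> fle x l"
      using 1 by (simp_all add: opt_mult_pair)
    then show ?case
      by (subst (1 2) fle.simps) (auto simp: lopts_fneg ropts_fneg)
  qed
qed

lemma fadd_fneg: "fle (fadd x (fneg x)) fzero \<and> fle fzero (fadd x (fneg x))"
proof (induction x rule: form_induct)
  case (1 x)
  have "fle (fadd x (fneg x)) fzero"
  proof (rule fleI)
    fix l assume "l \<in> lopts (fadd x (fneg x))"
    then consider xl where "xl \<in> lopts x" "l = fadd xl (fneg x)"
      | xr where "xr \<in> ropts x" "l = fadd x (fneg xr)"
      by (auto simp: lopts_fadd lopts_fneg)
    then show "\<not> fle fzero l"
    proof cases
      case a: 1
      then have "fadd xl (fneg xl) \<in> ropts l" by (simp add: ropts_fadd ropts_fneg)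
      then show ?thesis using 1 a fle_ropt by blast
    next
      case a: 2
      then have "fadd xr (fneg xr) \<in> ropts l" by (simp add: ropts_fadd)
      then show ?thesis using 1 a fle_ropt by blast
    qed
  qed simp
  moreover have "fle fzero (fadd x (fneg x))"
  proof (rule fleI)
    fix r assume "r \<in> ropts (fadd x (fneg x))"
    then consider xr where "xr \<in> ropts x" "r = fadd xr (fneg x)"
      | xl where "xl \<in> lopts x" "r = fadd x (fneg xl)"
      by (auto simp: ropts_fadd ropts_fneg)
    then show "\<not> fle r fzero"
    proof cases
      case a: 1
      then have "fadd xr (fneg xr) \<in> lopts r" by (simp add: lopts_fadd lopts_fneg)
      then show ?thesis using 1 a fle_lopt by blast
    next
      case a: 2
      then have "fadd xl (fneg xl) \<in> lopts r" by (simp add: lopts_fadd)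
      then show ?thesis using 1 a fle_lopt by blast
    qed
  qed simp
  ultimately show ?case by blast
qed

lemma fadd_fzero: "num x \<Longrightarrow> fadd x fzero = x"
proof (induction x rule: num.induct)
  case (1 L R)
  then show ?case by (subst fadd.simps) (simp cong: image_cong)
qed

lemma num_iff:
  "num x \<longleftrightarrow> x = form (lopts x) (ropts x) \<and> (\<forall>l\<in>lopts x. num l) \<and> (\<forall>r\<in>ropts x. num r) \<and>
             (\<forall>l\<in>lopts x. \<forall>r\<in>ropts x. \<not> fle r l)"
proof
  assume "num x"
  then show "x = form (lopts x) (ropts x) \<and> (\<forall>l\<in>lopts x. num l) \<and> (\<forall>r\<in>ropts x. num r) \<and>
             (\<forall>l\<in>lopts x. \<forall>r\<in>ropts x. \<not> fle r l)"
    by cases simp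
next
  assume *: "x = form (lopts x) (ropts x) \<and> (\<forall>l\<in>lopts x. num l) \<and> (\<forall>r\<in>ropts x. num r) \<and>
             (\<forall>l\<in>lopts x. \<forall>r\<in>ropts x. \<not> fle r l)"
  have "num (form (lopts x) (ropts x))"
    by (rule num.intros) (use * in auto)
  with * show "num x" by simp
qed

lemma num_opts:
  assumes "num x"
  shows "(\<forall>l\<in>lopts x. fle l x) \<and> (\<forall>r\<in>ropts x. fle x r)"
  using assms
proof (induction x rule: num.induct)
  case (1 L R)
  have "fle l (form L R)" if l: "l \<in> L" for l
  proof (rule fleI)
    fix k assume "k \<in> lopts l"
    then have "fle k l" using 1 l by blast
    show "\<not> fle (form L R) k"
    proof
      assume "fle (form L R) k"
      with \<open>fle k l\<close> have "fle (form L R) l" by (blast intro: fle_trans)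
      moreover have "\<not> fle (form L R) l"
        by (rule fle_lopt[OF fle_refl]) (simp add: 1 l)
      ultimately show False by blast
    qed
  qed (use 1 l in auto)
  moreover have "fle (form L R) r" if r: "r \<in> R" for r
  proof (rule fleI)
    fix k assume "k \<in> ropts r"
    then have "fle r k" using 1 r by blast
    show "\<not> fle k (form L R)"
    proof
      assume "fle k (form L R)"
      with \<open>fle r k\<close> have "fle r (form L R)" by (blast intro: fle_trans)
      moreover have "\<not> fle r (form L R)"
        by (rule fle_ropt[OF fle_refl]) (simp add: 1 r)
      ultimately show False by blast
    qed
  qed (use 1 r in auto)
  ultimately show ?case by (simp add: 1)
qed

lemma num_linear:
  assumes "num x" "num y"
  shows "fle x y \<or> fle y x"
proof (rule ccontr)
  assume n: "\<not> (fle x y \<or> fle y x)"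
  then consider l where "l \<in> lopts x" "fle y l" | r where "r \<in> ropts y" "fle r x"
    by (subst (asm) (1) fle.simps) blast
  then show False
  proof cases
    case 1
    then show ?thesis using n num_opts[OF assms(1)] fle_trans by blast
  next
    case 2
    then show ?thesis using n num_opts[OF assms(2)] fle_trans by blast
  qed
qed

lemma num_fzero: "num fzero"
  unfolding fzero_def by (rule num.intros) auto

lemma num_fneg: "num x \<Longrightarrow> num (fneg x)"
proof (induction x rule: num.induct)
  case (1 L R)
  show ?case
    by (subst fneg.simps, rule num.intros) (use 1 in \<open>auto simp: fle_fneg_iff\<close>)
qed

lemma num_fadd:
  assumes "num x" "num y"
  shows "num (fadd x y)"
proof -
  let ?m = "\<lambda>(x, y). {#x, y::'a#}"
  show ?thesis using assms
  proof (induction "(x, y)" arbitrary: x y rule: wf_induct_rule[OF wf_inv_image[OF wf_opt_mult, of ?m]])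
    case (1 x y)
    have X: "num (fadd l y)" if "l \<in> lopts x \<or> l \<in> ropts x" for l
      by (rule "1.hyps") (use that 1(2,3) num_iff[of x] in \<open>auto simp: opt_mult_pair\<close>)
    have Y: "num (fadd x l)" if "l \<in> lopts y \<or> l \<in> ropts y" for l
      by (rule "1.hyps") (use that 1(2,3) num_iff[of y] in \<open>auto simp: opt_mult_pair\<close>)
    have mono: "fle (fadd u y) (fadd v y) \<longleftrightarrow> fle u v" for u v
      using fle_fadd_iff fadd_comm by metis
    have lx: "\<not> fle (fadd x y) (fadd l y)" if "l \<in> lopts x" for l
      using that mono fle_lopt[OF fle_refl] by blast
    have ly: "\<not> fle (fadd x y) (fadd x l)" if "l \<in> lopts y" for l
      using that fle_fadd_iff fle_lopt[OF fle_refl] by blast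
    have rx: "fle (fadd x y) (fadd r y)" if "r \<in> ropts x" for r
      using that mono num_opts[OF 1(2)] by blast
    have ry: "fle (fadd x y) (fadd x r)" if "r \<in> ropts y" for r
      using that fle_fadd_iff num_opts[OF 1(3)] by blast
    show ?case
    proof (subst fadd.simps, rule num.intros)
      fix l r
      assume "l \<in> (\<lambda>l. fadd l y) ` lopts x \<union> (\<lambda>l. fadd x l) ` lopts y"
        and "r \<in> (\<lambda>r. fadd r y) ` ropts x \<union> (\<lambda>r. fadd x r) ` ropts y"
      then have "\<not> fle (fadd x y) l" "fle (fadd x y) r"
        using lx ly rx ry by auto
      then show "\<not> fle r l" using fle_trans by blast
    qed (use X Y in auto)
  qed
qed


lemma fadd_mono:
  assumes "fle x x'" "fle y y'"
  shows "fle (fadd x y) (fadd x' y')"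
proof (rule fle_trans)
  show "fle (fadd x y) (fadd x y')" using assms(2) by (simp only: fle_fadd_iff)
  have "fle (fadd y' x) (fadd y' x')" using assms(1) by (simp only: fle_fadd_iff)
  then show "fle (fadd x y') (fadd x' y')" by (simp only: fadd_comm[of _ y'])
qed


subsection \<open>The ordered group of surreal numbers\<close>

text \<open>Surreal numbers are number forms up to equality, where two forms are equal if each is
  at most the other.\<close>

definition feq :: "'v::zfc_universe \<Rightarrow> 'v \<Rightarrow> bool"
  where "feq x y \<longleftrightarrow> num x \<and> num y \<and> fle x y \<and> fle y x"

quotient_type (overloaded) 'v surreal = "'v::zfc_universe" / partial: feq morphisms Rep_surreal Abs_surreal
proof (rule part_equivpI)
  show "\<exists>x. feq x x" using num_fzero by (auto simp: feq_def)
  show "symp feq" by (auto simp: feq_def symp_def)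
  show "transp feq" unfolding feq_def transp_def using fle_trans by blast
qed

instantiation surreal :: (zfc_universe) "{linordered_ab_group_add, abs_if}"
begin

lift_definition zero_surreal :: "'a surreal" is fzero
  by (simp add: feq_def num_fzero)

lift_definition plus_surreal :: "'a surreal \<Rightarrow> 'a surreal \<Rightarrow> 'a surreal" is fadd
  by (simp add: feq_def num_fadd fadd_mono)

lift_definition uminus_surreal :: "'a surreal \<Rightarrow> 'a surreal" is fneg
  by (simp add: feq_def fle_fneg_iff num_fneg)

lift_definition less_eq_surreal :: "'a surreal \<Rightarrow> 'a surreal \<Rightarrow> bool" is fle
  unfolding feq_def using fle_trans by blast

definition less_surreal :: "'a surreal \<Rightarrow> 'a surreal \<Rightarrow> bool"
  where "x < y \<longleftrightarrow> x \<le> y \<and> \<not> y \<le> (x :: 'a surreal)"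

definition minus_surreal :: "'a surreal \<Rightarrow> 'a surreal \<Rightarrow> 'a surreal"
  where "x - y = x + - (y :: 'a surreal)"

definition abs_surreal :: "'a surreal \<Rightarrow> 'a surreal"
  where "\<bar>x\<bar> = (if x < 0 then - x else x :: 'a surreal)"

instance
proof
  fix x y z :: "'a surreal"
  show "x + y + z = x + (y + z)"
    by transfer (simp add: feq_def fadd_assoc num_fadd)
  show "x + y = y + x"
    by transfer (metis feq_def fadd_comm fle_refl num_fadd)
  show "0 + x = x"
    by transfer (metis feq_def fadd_comm fadd_fzero)
  show "- x + x = 0"
    by transfer (metis feq_def fadd_comm fadd_fneg num_fadd num_fneg num_fzero)
  show "x - y = x + - y" by (simp add: minus_surreal_def)
  show "x < y \<longleftrightarrow> x \<le> y \<and> \<not> y \<le> x" by (simp add: less_surreal_def)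
  show "x \<le> x" by transfer simp
  show "x \<le> y \<Longrightarrow> y \<le> z \<Longrightarrow> x \<le> z" by transfer (rule fle_trans)
  show "x \<le> y \<Longrightarrow> y \<le> x \<Longrightarrow> x = y" by transfer (simp add: feq_def)
  show "x \<le> y \<or> y \<le> x" by transfer (simp add: feq_def num_linear)
  show "x \<le> y \<Longrightarrow> z + x \<le> z + y" by transfer (simp add: fle_fadd_iff)
  show "\<bar>x\<bar> = (if x < 0 then - x else x)" by (simp add: abs_surreal_def)
qed

end

lemma num_between:
  assumes "num x" "num y" "\<not> fle y x"
  shows "num (form {x} {y})" "fle x (form {x} {y})" "\<not> fle (form {x} {y}) x"
    "fle (form {x} {y}) y" "\<not> fle y (form {x} {y})"
proof -
  let ?z = "form {x} {y}"
  show n: "num ?z" by (rule num.intros) (use assms in auto)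
  show "fle x ?z" "fle ?z y" using num_opts[OF n] by auto
  show "\<not> fle ?z x" by (rule fle_lopt[OF fle_refl]) simp
  show "\<not> fle y ?z" by (rule fle_ropt[OF fle_refl]) simp
qed

lemma num_above:
  assumes "num x"
  shows "num (form {x} {})" "fle x (form {x} {})" "\<not> fle (form {x} {}) x"
proof -
  let ?z = "form {x} {}"
  show n: "num ?z" by (rule num.intros) (use assms in auto)
  show "fle x ?z" using num_opts[OF n] by auto
  show "\<not> fle ?z x" by (rule fle_lopt[OF fle_refl]) simp
qed

instance surreal :: (zfc_universe) dense_linorder
proof
  fix x y :: "'a surreal"
  assume "x < y"
  then show "\<exists>z. x < z \<and> z < y"
    unfolding less_surreal_def
  proof (transfer, goal_cases)
    case (1 x y)
    with num_between[of x y] show ?case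
      by (intro bexI[of _ "form {x} {y}"]) (auto simp: feq_def Respects_def)
  qed
qed

lemma surreal_no_max: "\<exists>y. x < (y :: 'v::zfc_universe surreal)"
  unfolding less_surreal_def
proof (transfer, goal_cases)
  case (1 x)
  with num_above[of x] show ?case
    by (intro bexI[of _ "form {x} {}"]) (auto simp: feq_def Respects_def)
qed


section \<open>The Dedekind completion\<close>

definition dedekind_section :: "'v::zfc_universe surreal set \<Rightarrow> 'v surreal set \<Rightarrow> bool"
  where "dedekind_section L R \<longleftrightarrow> L \<union> R = UNIV \<and> \<not> (\<exists>a\<in>L. \<exists>b\<in>R. a \<ge> b)"

text \<open>Either class of a section may be empty, so the two improper gaps
  above and below all numbers are included.\<close>

typedef (overloaded) ('v::zfc_universe) gap =
  "{(L, R :: 'v surreal set). dedekind_section L R \<and>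
      \<not> (\<exists>x. (L, R) = ({..<x}, {x..}) \<or> (L, R) = ({..x}, {x<..}))}"
proof
  have "UNIV \<noteq> {..<x}" "UNIV \<noteq> {..x}" for x :: "'v surreal"
    using surreal_no_max[of x] by (auto simp: set_eq_iff not_le)
  then show "(UNIV, {}) \<in> {(L, R :: 'v surreal set). dedekind_section L R \<and>
      \<not> (\<exists>x. (L, R) = ({..<x}, {x..}) \<or> (L, R) = ({..x}, {x<..}))}"
    by (auto simp: dedekind_section_def)
qed

definition gap_left :: "'v::zfc_universe gap \<Rightarrow> 'v surreal set"
  where "gap_left g = fst (Rep_gap g)"

definition gap_right :: "'v::zfc_universe gap \<Rightarrow> 'v surreal set"
  where "gap_right g = snd (Rep_gap g)"

declare [[typedef_overloaded]]

datatype ('v::zfc_universe) dedekind_completion = Number "'v surreal" | Gap "'v gap"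

lemma gap_section: "dedekind_section (gap_left g) (gap_right g)"
  using Rep_gap[of g] by (auto simp: gap_left_def gap_right_def)

lemma gap_right_eq: "gap_right g = - gap_left g"
  using gap_section[of g] by (fastforce simp: dedekind_section_def)

lemma gap_left_down: "y \<in> gap_left g \<Longrightarrow> x \<le> y \<Longrightarrow> x \<in> gap_left g"
  using gap_section[of g] by (auto simp: dedekind_section_def)

lemma gap_left_not_number: "gap_left g \<noteq> {..<x}" "gap_left g \<noteq> {..x}"
proof -
  have "\<not> ((gap_left g, gap_right g) = ({..<x}, {x..}) \<or> (gap_left g, gap_right g) = ({..x}, {x<..}))"
    using Rep_gap[of g] by (auto simp: gap_left_def gap_right_def)
  moreover have "- {..<x} = {x..}" "- {..x} = {x<..}" by auto
  ultimately show "gap_left g \<noteq> {..<x}" "gap_left g \<noteq> {..x}"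
    by (auto simp: gap_right_eq)
qed

lemma gap_left_inject: "gap_left g = gap_left h \<longleftrightarrow> g = h"
  by (metis Rep_gap_inject gap_left_def gap_right_def gap_right_eq prod_eqI)

lemma obtain_gap:
  assumes "dedekind_section L R" "\<And>x. L \<noteq> {..<x}" "\<And>x. L \<noteq> {..x}"
  obtains g where "gap_left g = L"
proof
  have "(L, R) \<in> {(L, R). dedekind_section L R \<and>
      \<not> (\<exists>x. (L, R) = ({..<x}, {x..}) \<or> (L, R) = ({..x}, {x<..}))}"
    using assms by auto
  from Abs_gap_inverse[OF this] show "gap_left (Abs_gap (L, R)) = L"
    by (simp add: gap_left_def)
qed

instantiation dedekind_completion :: (zfc_universe) linorder
begin

fun less_eq_dedekind_completion :: "'a dedekind_completion \<Rightarrow> 'a dedekind_completion \<Rightarrow> bool"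
  where
    "Number x \<le> Number y \<longleftrightarrow> x \<le> y"
  | "Number x \<le> Gap g \<longleftrightarrow> x \<in> gap_left g"
  | "Gap g \<le> Number x \<longleftrightarrow> x \<in> gap_right g"
  | "Gap g \<le> Gap h \<longleftrightarrow> gap_left g \<subseteq> gap_left h"

definition less_dedekind_completion :: "'a dedekind_completion \<Rightarrow> 'a dedekind_completion \<Rightarrow> bool"
  where "x < y \<longleftrightarrow> x \<le> y \<and> \<not> y \<le> (x :: 'a dedekind_completion)"

instance
proof
  fix x y z :: "'a dedekind_completion"
  show "x < y \<longleftrightarrow> x \<le> y \<and> \<not> y \<le> x" by (simp add: less_dedekind_completion_def)
  show "x \<le> x" by (cases x) auto
  show "x \<le> y \<Longrightarrow> y \<le> x \<Longrightarrow> x = y"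
    by (cases x; cases y) (auto simp: gap_right_eq gap_left_inject[symmetric])
  show "x \<le> y \<Longrightarrow> y \<le> z \<Longrightarrow> x \<le> z"
    by (cases x; cases y; cases z)
       (auto simp: gap_right_eq intro: gap_left_down, (meson gap_left_down linear)+)
  show "x \<le> y \<or> y \<le> x"
    by (cases x; cases y) (auto simp: gap_right_eq, (meson gap_left_down linear)+)
qed

end

lemma dedekind_completion_less [simp]:
  "Number x < Number y \<longleftrightarrow> x < y"
  "Number x < Gap g \<longleftrightarrow> x \<in> gap_left g"
  "Gap g < Number x \<longleftrightarrow> x \<in> gap_right g"
  by (auto simp: less_dedekind_completion_def gap_right_eq)

lemma dedekind_completion_lub:
  fixes S :: "'v::zfc_universe dedekind_completion set"
  shows "\<exists>u. (\<forall>s\<in>S. s \<le> u) \<and> (\<forall>v. (\<forall>s\<in>S. s \<le> v) \<longrightarrow> u \<le> v)"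
proof -
  define L where "L = {x. \<exists>s\<in>S. Number x < s}"
  have sec: "dedekind_section L (- L)"
    unfolding dedekind_section_def L_def by auto (metis dedekind_completion_less(1) le_less less_trans)
  have below: "x \<in> L" if "s \<in> S" "Number x < s" for s x
    using that by (auto simp: L_def)
  consider x where "L = {..<x}" | x where "L = {..x}" | g where "gap_left g = L"
    using obtain_gap[OF sec] by metis
  then show ?thesis
  proof cases
    case 1
    show ?thesis
    proof (intro exI conjI ballI allI impI)
      fix s assume "s \<in> S"
      then show "s \<le> Number x" using below[of s x] 1 by (auto simp: not_le[symmetric])
    next
      fix v assume v: "\<forall>s\<in>S. s \<le> v"
      show "Number x \<le> v"
      proof (cases v)
        case (Number y)
        have "\<not> y < x"
        proof
          assume "y < x"
          then have "y \<in> L" using 1 by simp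
          then show False using v Number by (auto simp: L_def not_le[symmetric])
        qed
        then show ?thesis using Number by simp
      next
        case (Gap g)
        show ?thesis
        proof (rule ccontr)
          assume "\<not> Number x \<le> v"
          then have "x \<notin> gap_left g" using Gap by simp
          moreover have "y \<in> gap_left g" if "y < x" for y
          proof -
            from that have "y \<in> L" using 1 by simp
            then obtain s where "s \<in> S" "Number y < s" by (auto simp: L_def)
            then have "Number y < v" using v by (meson less_le_trans)
            then show ?thesis using Gap by simp
          qed
          ultimately have "gap_left g = {..<x}"
            by (auto simp: not_le[symmetric] intro: gap_left_down)
          then show False using gap_left_not_number by blast
        qed
      qed
    qed
  next
    case 2
    then obtain s where s: "s \<in> S" "Number x < s" by (auto simp: L_def)
    then have "\<exists>y>x. Number y < s"
    proof (cases s)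
      case (Number z)
      then show ?thesis using s dense[of x z] by auto
    next
      case (Gap g)
      then have "{..x} \<subseteq> gap_left g" using s by (auto intro: gap_left_down)
      then show ?thesis using gap_left_not_number(2)[of g x] Gap by (auto simp: not_le)
    qed
    then show ?thesis using below[OF s(1)] 2 by fastforce
  next
    case 3
    show ?thesis
    proof (intro exI conjI ballI allI impI)
      fix s assume s: "s \<in> S"
      show "s \<le> Gap g"
      proof (cases s)
        case (Number y)
        show ?thesis
        proof (rule ccontr)
          assume "\<not> s \<le> Gap g"
          then have y: "y \<notin> L" using Number 3 by simp
          have "L = {..<y}"
          proof (intro equalityI subsetI)
            fix z assume "z \<in> L"
            then show "z \<in> {..<y}" using y 3 gap_left_down[of z g y] by (auto simp: not_le[symmetric])
          qed (use below[OF s] Number in auto)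
          then show False using 3 gap_left_not_number by blast
        qed
      next
        case (Gap h)
        then show ?thesis using below[OF s] 3 by auto
      qed
    next
      fix v assume v: "\<forall>s\<in>S. s \<le> v"
      have L: "Number y < v" if "y \<in> L" for y
        using that v unfolding L_def by (auto intro: less_le_trans)
      show "Gap g \<le> v"
      proof (cases v)
        case (Number y)
        then show ?thesis using L[of y] 3 by (auto simp: gap_right_eq)
      next
        case (Gap h)
        then show ?thesis using L 3 by auto
      qed
    qed
  qed
qed

lemma dedekind_completion_glb:
  fixes S :: "'v::zfc_universe dedekind_completion set"
  shows "\<exists>u. (\<forall>s\<in>S. u \<le> s) \<and> (\<forall>v. (\<forall>s\<in>S. v \<le> s) \<longrightarrow> v \<le> u)"
  using dedekind_completion_lub[of "{v. \<forall>s\<in>S. v \<le> s}"] by auto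

instantiation dedekind_completion :: (zfc_universe) complete_linorder
begin

definition Sup_dedekind_completion :: "'a dedekind_completion set \<Rightarrow> 'a dedekind_completion"
  where "Sup_dedekind_completion S = (LEAST u. \<forall>s\<in>S. s \<le> u)"

definition Inf_dedekind_completion :: "'a dedekind_completion set \<Rightarrow> 'a dedekind_completion"
  where "Inf_dedekind_completion S = (GREATEST u. \<forall>s\<in>S. u \<le> s)"

definition sup_dedekind_completion ::
    "'a dedekind_completion \<Rightarrow> 'a dedekind_completion \<Rightarrow> 'a dedekind_completion"
  where "sup x y = max x (y :: 'a dedekind_completion)"

definition inf_dedekind_completion ::
    "'a dedekind_completion \<Rightarrow> 'a dedekind_completion \<Rightarrow> 'a dedekind_completion"
  where "inf x y = min x (y :: 'a dedekind_completion)"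

definition bot_dedekind_completion :: "'a dedekind_completion"
  where "bot = Sup ({} :: 'a dedekind_completion set)"

definition top_dedekind_completion :: "'a dedekind_completion"
  where "top = Inf ({} :: 'a dedekind_completion set)"

lemma Sup_dedekind_completion:
  "(\<forall>s\<in>S. s \<le> Sup S) \<and> (\<forall>v. (\<forall>s\<in>S. s \<le> v) \<longrightarrow> Sup S \<le> (v :: 'a dedekind_completion))"
proof -
  obtain u where "\<forall>s\<in>S. s \<le> u" "\<forall>v. (\<forall>s\<in>S. s \<le> v) \<longrightarrow> u \<le> v"
    using dedekind_completion_lub by blast
  moreover from this have "Sup S = u"
    unfolding Sup_dedekind_completion_def by (intro Least_equality) auto
  ultimately show ?thesis by simp
qed

lemma Inf_dedekind_completion:
  "(\<forall>s\<in>S. Inf S \<le> s) \<and> (\<forall>v. (\<forall>s\<in>S. v \<le> s) \<longrightarrow> v \<le> Inf (S :: 'a dedekind_completion set))"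
proof -
  obtain u where "\<forall>s\<in>S. u \<le> s" "\<forall>v. (\<forall>s\<in>S. v \<le> s) \<longrightarrow> v \<le> u"
    using dedekind_completion_glb by blast
  moreover from this have "Inf S = u"
    unfolding Inf_dedekind_completion_def by (intro Greatest_equality) auto
  ultimately show ?thesis by simp
qed

instance
  by standard
    (use Sup_dedekind_completion Inf_dedekind_completion in
      \<open>auto simp: sup_dedekind_completion_def inf_dedekind_completion_def
        bot_dedekind_completion_def top_dedekind_completion_def\<close>)

end


section \<open>Limits of sequences indexed by the ordinals\<close>

definition below_class :: "'v::zfc_universe dedekind_completion \<Rightarrow> 'v surreal set"
  where "below_class x = {y. Number y < x}"

definition above_class :: "'v::zfc_universe dedekind_completion \<Rightarrow> 'v surreal set"
  where "above_class x = {y. x < Number y}"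

text \<open>
  A form with classes of numbers on either side is represented by the pair of these classes.
\<close>

definition dedekind_rep ::
    "'v::zfc_universe dedekind_completion \<Rightarrow> 'v surreal set \<times> 'v surreal set"
  where "dedekind_rep x = (below_class x, above_class x)"

definition is_dedekind_rep :: "'v::zfc_universe surreal set \<times> 'v surreal set \<Rightarrow> bool"
  where "is_dedekind_rep F \<longleftrightarrow> (\<exists>x. F = dedekind_rep x)"

definition dedekind_value :: "'v::zfc_universe surreal set \<times> 'v surreal set \<Rightarrow> 'v dedekind_completion"
  where "dedekind_value F = (THE x. F = dedekind_rep x)"

lemma dedekind_rep_inject: "dedekind_rep x = dedekind_rep y \<longleftrightarrow> x = y"
proof
  assume "dedekind_rep x = dedekind_rep y"
  then have *: "\<And>z. Number z < x \<longleftrightarrow> Number z < y" "\<And>z. x < Number z \<longleftrightarrow> y < Number z"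
    by (auto simp: dedekind_rep_def below_class_def above_class_def)
  show "x = y"
  proof (cases "(\<exists>z. x = Number z) \<or> (\<exists>z. y = Number z)")
    case True
    then show ?thesis using * by (metis less_irrefl linorder_neqE)
  next
    case False
    then obtain g h where "x = Gap g" "y = Gap h" by (metis dedekind_completion.exhaust)
    then show ?thesis using *(1) by (auto simp: gap_left_inject[symmetric])
  qed
qed simp

lemma dedekind_value_rep [simp]: "dedekind_value (dedekind_rep x) = x"
  unfolding dedekind_value_def dedekind_rep_inject by (rule the_equality) simp_all

text \<open>
  A sequence starts at index 1; its value at the ordinal 0 is never used.
\<close>

definition ell_form ::
    "('v::zfc_universe ordinal \<Rightarrow> 'v dedekind_completion) \<Rightarrow> 'v surreal set \<times> 'v surreal set"
  where "ell_form a =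
    ({x. Number x < Sup (Number ` (\<Union>i\<in>{1..}. \<Inter>j\<in>{i..}. below_class (a j)))},
     {x. Number x > Inf (Number ` (\<Union>i\<in>{1..}. \<Inter>j\<in>{i..}. above_class (a j)))})"

definition has_limit ::
    "('v::zfc_universe ordinal \<Rightarrow> 'v dedekind_completion) \<Rightarrow> 'v dedekind_completion \<Rightarrow> bool"
  where "has_limit a l \<longleftrightarrow> is_dedekind_rep (ell_form a) \<and> l = dedekind_value (ell_form a)"

end

theory Submission
  imports Defs "HOL.Filter"
begin

text \<open>
  Since there is no largest ordinal, "for all sufficiently large \<open>n\<close>" is quantification along a
  proper filter on the ordinals. Let \<open>A\<close> be the class of numbers that are eventually below the
  sequence, and \<open>B\<close> the class of numbers that are eventually above it; these are the two classes
  whose supremum and infimum form \<^const>\<open>ell_form\<close>. As \<open>A\<close> is closed downwards and the numbers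
  are densely ordered, \<open>sup A\<close> is the number \<open>l\<close> exactly if \<open>A\<close> contains all numbers below \<open>l\<close> and
  none above \<open>l\<close> (lemma \<open>below_Sup_eq_lessThan_iff\<close>), and dually for \<open>B\<close>.

  No number can be eventually below and eventually above the sequence at once. So if \<open>B\<close> contains
  everything above \<open>l\<close>, then \<open>A\<close> contains nothing there, and conversely: of the four inclusions
  only two remain, namely that every \<open>y < l\<close> is eventually below and every \<open>y > l\<close> eventually
  above the sequence (lemma \<open>has_limit_Number_iff\<close>). Writing \<open>y = l - \<epsilon>\<close> and \<open>y = l + \<epsilon>\<close> turns
  this into the \<open>\<epsilon>\<close>-criterion. Both directions of the theorem are thus one equivalence.
\<close>

lemma Ord_insert_self:
  assumes "Ord x"
  shows "Ord (vset (insert x (elts x)))"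
proof -
  have "small (insert x (elts x))"
    using small_Un[OF small_singleton small_elts, of x x] by simp
  then show ?thesis
    using assms by (auto simp: Ord_def Transset_def)
qed

text \<open>The successor is a larger ordinal. Hence the open rays \<open>n > N\<close> are nonempty and generate the
  same filter as the closed rays \<open>j \<ge> i\<close> that occur in \<^const>\<open>ell_form\<close>.\<close>

instance ordinal :: (zfc_universe) no_top
proof
  fix \<alpha> :: "'a ordinal"
  let ?x = "Rep_ordinal \<alpha>"
  have small: "small (insert ?x (elts ?x))"
    using small_Un[OF small_singleton small_elts, of ?x ?x] by simp
  have "Rep_ordinal (Abs_ordinal (vset (insert ?x (elts ?x)))) = vset (insert ?x (elts ?x))"
    using Ord_insert_self Rep_ordinal[of \<alpha>] by (intro Abs_ordinal_inverse) simp
  with small have "\<alpha> < Abs_ordinal (vset (insert ?x (elts ?x)))"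
    by (simp add: less_ordinal_def)
  then show "\<exists>\<beta>. \<alpha> < \<beta>" ..
qed

text \<open>This puts the classes in \<^const>\<open>ell_form\<close> into filter form. Sequences start at index 1, but a
  tail of the ordinals can always be shortened to one that starts at 1 or later.\<close>

lemma UN_INT_tail_eq_eventually:
  fixes X :: "'v::zfc_universe ordinal \<Rightarrow> 'b set"
  shows "(\<Union>i\<in>{k..}. \<Inter>j\<in>{i..}. X j) = {y. eventually (\<lambda>j. y \<in> X j) at_top}"
proof (intro equalityI subsetI)
  fix y assume "y \<in> {y. eventually (\<lambda>j. y \<in> X j) at_top}"
  then obtain N where N: "y \<in> X j" if "j \<ge> N" for j
    by (auto simp: eventually_at_top_linorder)
  then have "y \<in> (\<Inter>j\<in>{max k N..}. X j)" by simp
  then show "y \<in> (\<Union>i\<in>{k..}. \<Inter>j\<in>{i..}. X j)"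
    by (intro UN_I[of "max k N"]) simp_all
qed (auto simp: eventually_at_top_linorder)

text \<open>The numbers below \<open>sup A\<close> are those below some member of \<open>A\<close>. Density is what brings each
  \<open>x < l\<close> under this condition: a number strictly between \<open>x\<close> and \<open>l\<close> is again in \<open>A\<close>. The number
  \<open>l\<close> itself may or may not be in \<open>A\<close>, as it does not affect the supremum.\<close>

lemma below_Sup_eq_lessThan_iff:
  fixes A :: "'v::zfc_universe surreal set"
  assumes down: "\<And>x y. y \<in> A \<Longrightarrow> x \<le> y \<Longrightarrow> x \<in> A"
  shows "{x. Number x < Sup (Number ` A)} = {..<l} \<longleftrightarrow> {..<l} \<subseteq> A \<and> A \<subseteq> {..l}"
proof -
  have *: "{x. Number x < Sup (Number ` A)} = {x. \<exists>y\<in>A. x < y}"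
    by (simp add: less_Sup_iff)
  show ?thesis
    unfolding *
  proof safe
    fix x assume "{x. \<exists>y\<in>A. x < y} = {..<l}" "x < l"
    then obtain y where "y \<in> A" "x < y" by blast
    then show "x \<in> A" using down by auto
  next
    fix y assume "{x. \<exists>y\<in>A. x < y} = {..<l}" "y \<in> A"
    then have "\<not> l < y" by blast
    then show "y \<le> l" by simp
  next
    fix x assume "{..<l} \<subseteq> A" "x < l"
    then show "\<exists>y\<in>A. x < y" using dense[of x l] by auto
  qed auto
qed

lemma above_Inf_eq_greaterThan_iff:
  fixes B :: "'v::zfc_universe surreal set"
  assumes up: "\<And>x y. y \<in> B \<Longrightarrow> y \<le> x \<Longrightarrow> x \<in> B"
  shows "{x. Number x > Inf (Number ` B)} = {l<..} \<longleftrightarrow> {l<..} \<subseteq> B \<and> B \<subseteq> {l..}"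
proof -
  have *: "{x. Number x > Inf (Number ` B)} = {x. \<exists>y\<in>B. y < x}"
    by (simp add: Inf_less_iff)
  show ?thesis
    unfolding *
  proof safe
    fix x assume "{x. \<exists>y\<in>B. y < x} = {l<..}" "l < x"
    then obtain y where "y \<in> B" "y < x" by blast
    then show "x \<in> B" using up by auto
  next
    fix y assume "{x. \<exists>y\<in>B. y < x} = {l<..}" "y \<in> B"
    then have "\<not> y < l" by blast
    then show "l \<le> y" by simp
  next
    fix x assume "{l<..} \<subseteq> B" "l < x"
    then show "\<exists>y\<in>B. y < x" using dense[of l x] by auto
  qed auto
qed

lemma has_limit_iff_ell_form: "has_limit a x \<longleftrightarrow> ell_form a = dedekind_rep x"
  by (auto simp: has_limit_def is_dedekind_rep_def)

text \<open>The order-theoretic form of convergence, which makes sense without subtraction. The inclusions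
  that say what is not eventually below or above the sequence come for free: two properties that
  hold eventually hold together at some index.\<close>

lemma has_limit_Number_iff:
  fixes a :: "'v::zfc_universe ordinal \<Rightarrow> 'v surreal"
  shows "has_limit (\<lambda>i. Number (a i)) (Number l) \<longleftrightarrow>
    (\<forall>y<l. eventually (\<lambda>i. y < a i) at_top) \<and> (\<forall>y>l. eventually (\<lambda>i. a i < y) at_top)"
proof -
  define A where "A = {y. eventually (\<lambda>i. y < a i) at_top}"
  define B where "B = {y. eventually (\<lambda>i. a i < y) at_top}"
  have down: "x \<in> A" if "y \<in> A" "x \<le> y" for x y
    using that unfolding A_def by (auto elim: eventually_mono)
  have up: "x \<in> B" if "y \<in> B" "y \<le> x" for x y
    using that unfolding B_def by (auto elim: eventually_mono)
  have disjoint: "y \<notin> B" if "y \<in> A" for y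
  proof
    assume "y \<in> B"
    with that have "eventually (\<lambda>i. y < a i \<and> a i < y) at_top"
      by (simp add: A_def B_def eventually_conj)
    then obtain i where "y < a i \<and> a i < y"
      using eventually_happens' trivial_limit_at_top_linorder by blast
    then show False by auto
  qed
  have form: "ell_form (\<lambda>i. Number (a i)) =
      ({x. Number x < Sup (Number ` A)}, {x. Number x > Inf (Number ` B)})"
    unfolding ell_form_def UN_INT_tail_eq_eventually
    by (simp add: A_def B_def below_class_def above_class_def)
  have rep: "dedekind_rep (Number l) = ({..<l}, {l<..})"
    by (auto simp: dedekind_rep_def below_class_def above_class_def)
  have "has_limit (\<lambda>i. Number (a i)) (Number l) \<longleftrightarrow>
      ({..<l} \<subseteq> A \<and> A \<subseteq> {..l}) \<and> ({l<..} \<subseteq> B \<and> B \<subseteq> {l..})"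
    unfolding has_limit_iff_ell_form form rep prod.inject
    by (simp only: below_Sup_eq_lessThan_iff[OF down] above_Inf_eq_greaterThan_iff[OF up])
  also have "\<dots> \<longleftrightarrow> {..<l} \<subseteq> A \<and> {l<..} \<subseteq> B"
  proof safe
    fix y assume "{l<..} \<subseteq> B" "y \<in> A"
    then have "\<not> l < y" using disjoint by auto
    then show "y \<le> l" by simp
  next
    fix y assume "{..<l} \<subseteq> A" "y \<in> B"
    then have "\<not> y < l" using disjoint by auto
    then show "l \<le> y" by simp
  qed
  also have "\<dots> \<longleftrightarrow>
      (\<forall>y<l. eventually (\<lambda>i. y < a i) at_top) \<and> (\<forall>y>l. eventually (\<lambda>i. a i < y) at_top)"
    by (auto simp: A_def B_def)
  finally show ?thesis .
qed

lemma surreal_abs_diff_less_iff: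
  fixes x l \<epsilon> :: "'v::zfc_universe surreal"
  assumes "\<epsilon> > 0"
  shows "\<bar>x - l\<bar> < \<epsilon> \<longleftrightarrow> l - \<epsilon> < x \<and> x < l + \<epsilon>"
proof -
  have less: "x < l + \<epsilon>" if "x < l"
    using add_strict_mono[OF that assms] by simp
  have greater: "l - \<epsilon> < x" if "l \<le> x"
    using add_less_le_mono[OF assms that] by (simp add: diff_less_eq add.commute)
  show ?thesis
    using less greater
    by (cases "x < l") (auto simp: abs_if diff_less_eq less_diff_eq add.commute not_less)
qed

lemma has_limit_Number_iff_abs_diff:
  fixes a :: "'v::zfc_universe ordinal \<Rightarrow> 'v surreal"
  shows "has_limit (\<lambda>i. Number (a i)) (Number l) \<longleftrightarrow>
    (\<forall>\<epsilon>>0. eventually (\<lambda>n. \<bar>a n - l\<bar> < \<epsilon>) at_top)"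
  unfolding has_limit_Number_iff
proof (intro iffI conjI allI impI)
  fix \<epsilon> :: "'v surreal"
  assume *: "(\<forall>y<l. eventually (\<lambda>i. y < a i) at_top) \<and> (\<forall>y>l. eventually (\<lambda>i. a i < y) at_top)"
    and \<epsilon>: "\<epsilon> > 0"
  have "l - \<epsilon> < l" "l < l + \<epsilon>"
    using \<epsilon> by (simp_all add: diff_less_eq)
  with * show "eventually (\<lambda>n. \<bar>a n - l\<bar> < \<epsilon>) at_top"
    by (simp add: surreal_abs_diff_less_iff[OF \<epsilon>] eventually_conj)
next
  fix y
  assume *: "\<forall>\<epsilon>>0. eventually (\<lambda>n. \<bar>a n - l\<bar> < \<epsilon>) at_top" and "y < l"
  then have \<epsilon>: "l - y > 0" by simp
  with * have "eventually (\<lambda>n. \<bar>a n - l\<bar> < l - y) at_top" by blast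
  then show "eventually (\<lambda>i. y < a i) at_top"
    by (rule eventually_mono) (simp add: surreal_abs_diff_less_iff[OF \<epsilon>])
next
  fix y
  assume *: "\<forall>\<epsilon>>0. eventually (\<lambda>n. \<bar>a n - l\<bar> < \<epsilon>) at_top" and "y > l"
  then have \<epsilon>: "y - l > 0" by simp
  with * have "eventually (\<lambda>n. \<bar>a n - l\<bar> < y - l) at_top" by blast
  then show "eventually (\<lambda>i. a i < y) at_top"
    by (rule eventually_mono) (simp add: surreal_abs_diff_less_iff[OF \<epsilon>])
qed

theorem theorem22:
  fixes a :: "'v::zfc_universe ordinal \<Rightarrow> 'v surreal"
  shows "(\<forall>l. has_limit (\<lambda>i. Number (a i)) (Number l) \<longrightarrow>
            (\<forall>\<epsilon>>0. \<exists>N. \<forall>n>N. \<bar>a n - l\<bar> < \<epsilon>)) \<and>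
         (\<forall>l. (\<forall>\<epsilon>>0. \<exists>N. \<forall>n>N. \<bar>a n - l\<bar> < \<epsilon>) \<longrightarrow>
            has_limit (\<lambda>i. Number (a i)) (Number l))"
  unfolding has_limit_Number_iff_abs_diff eventually_at_top_dense by blast

end
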